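(* Let $(\Omega,\Sigma,\mu)$ and $(\Omega,\Sigma,\nu)$ be two $\sigma$-finite measure spaces, let $p,q\in[1,+\infty]$, and let $g\in L_0(\Omega,\mu)$ be such that the multiplication operator $M_g:L_p(\Omega,\mu)\to L_q(\Omega,\nu)$, $f\mapsto g\cdot f$, is a well-defined bounded operator. Let $\nu=\rho_{\nu,\mu}\cdot\mu+\nu_s$ be the Lebesgue decomposition of $\nu$ with respect to $\mu$, with $\Omega=\Omega_c\sqcup\Omega_s$ and $\mu(\Omega_s)=\nu_s(\Omega_c)=0$. Then the following are equivalent: i) $M_g$ is isometric; ii) $M_g^{\Omega_c}:L_p(\Omega_c,\mu|_{\Omega_c})\to L_q(\Omega_c,\nu|_{\Omega_c})$ is isometric; iii) $\rho_{\nu,\mu}$ is positive, $|g\cdot\rho_{\nu,\mu}^{1/q}|_{\Omega_c}|=\mu(\Omega_c)^{1/p-1/q}$, and if $p\neq q$ the space $(\Omega,\Sigma,\mu)$ consists of a single atom.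
   Context: All linear spaces are over $\mathbb{C}$; measures are nonnegative, $\sigma$-additive, with values in $[0,+\infty]$. $L_0(\Omega,\mu)$ is the space of measurable complex functions on $\Omega$. If $p=\infty$ then $1/p=0$. For $p=q$ the quantity $\mu(\Omega_c)^{1/p-1/q}$ means $1$. Equalities and inequalities between functions (including positivity) are understood up to sets of measure zero (here with respect to $\mu$). For a nonnegative measurable $\rho$, $(\rho\cdot\mu)(E)=\int_E\rho\,d\mu$. Lebesgue decomposition of $\nu$ with respect to $\mu$: a nonnegative measurable function $\rho_{\nu,\mu}$, a $\sigma$-finite measure $\nu_s$ and a set $\Omega_s\in\Sigma$ such that $\nu=\rho_{\nu,\mu}\cdot\mu+\nu_s$ and $\mu(\Omega_s)=\nu_s(\Omega_c)=0$, where $\Omega_c=\Omega\setminus\Omega_s$. For $E\in\Sigma$, $M_g^E:L_p(E,\mu|_E)\to L_q(E,\nu|_E)$ is the operator $f\mapsto g|_E\cdot f$. An operator $T:X\to Y$ between normed spaces is isometric if $\|T(x)\|=\|x\|$ for all $x\in X$. An atom of $(\Omega,\Sigma,\mu)$ is a set $\Omega'\in\Sigma$ with $\mu(\Omega')>0$ such that for every $E\in\Sigma$ with $E\subset\Omega'$ either $\mu(E)=0$ or $\mu(\Omega'\setminus E)=0$. "Consists of a single atom" means that $\Omega$ itself is an atom.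
   Formalization: The formal statement additionally assumes μ(Ω) > 0 when p ≠ q; for μ = 0 and p ≠ q, conditions i) and ii) hold trivially while iii) fails because an atom must have positive measure. *)

theory Defs
  imports "HOL-Probability.Essential_Supremum"
begin

text \<open>Exponents range over \<open>[1, \<infinity>]\<close> inside \<^typ>\<open>ennreal\<close>; the library convention
  \<open>1 / \<infinity> = 0\<close> there makes the reciprocal of \<open>\<infinity>\<close> equal to 0.\<close>

definition recip :: "ennreal \<Rightarrow> real"
  where "recip p = enn2real (1 / p)"

text \<open>Real powers on \<open>[0, \<infinity>]\<close>. The exponent 0 always gives 1, also for the bases 0 and \<open>\<infinity>\<close>.\<close>

definition epow :: "ennreal \<Rightarrow> real \<Rightarrow> ennreal"
  where "epow x a =
    (if a = 0 then 1
     else if x = \<infinity> then (if 0 < a then \<infinity> else 0)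
     else if x = 0 then (if 0 < a then 0 else \<infinity>)
     else ennreal (enn2real x powr a))"

definition Lp_norm :: "ennreal \<Rightarrow> 'a measure \<Rightarrow> ('a \<Rightarrow> complex) \<Rightarrow> ennreal"
  where "Lp_norm p M f =
    (if p = \<infinity> then esssup M (\<lambda>x. ennreal (cmod (f x)))
     else epow (\<integral>\<^sup>+ x. ennreal (cmod (f x) powr enn2real p) \<partial>M) (recip p))"

text \<open>Elements of the Lebesgue spaces are represented by functions; two functions represent the
  same element iff they agree almost everywhere.\<close>

definition Lp :: "ennreal \<Rightarrow> 'a measure \<Rightarrow> ('a \<Rightarrow> complex) set"
  where "Lp p M = {f \<in> borel_measurable M. Lp_norm p M f < \<infinity>}"

text \<open>The map \<open>T\<close> on representatives induces a map of classes
  \<open>L\<^sub>p(M) \<rightarrow> L\<^sub>q(N)\<close>. The second conjunct has content: the two almost-everywhere relations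
  are taken with respect to different measures.\<close>

definition well_defined_Lp ::
    "ennreal \<Rightarrow> 'a measure \<Rightarrow> ennreal \<Rightarrow> 'a measure \<Rightarrow> (('a \<Rightarrow> complex) \<Rightarrow> ('a \<Rightarrow> complex)) \<Rightarrow> bool"
  where "well_defined_Lp p M q N T \<longleftrightarrow>
    (\<forall>f\<in>Lp p M. T f \<in> Lp q N) \<and>
    (\<forall>f\<in>Lp p M. \<forall>h\<in>Lp p M. (AE x in M. f x = h x) \<longrightarrow> (AE x in N. T f x = T h x))"

definition bounded_Lp ::
    "ennreal \<Rightarrow> 'a measure \<Rightarrow> ennreal \<Rightarrow> 'a measure \<Rightarrow> (('a \<Rightarrow> complex) \<Rightarrow> ('a \<Rightarrow> complex)) \<Rightarrow> bool"
  where "bounded_Lp p M q N T \<longleftrightarrow>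
    (\<exists>C::real. 0 \<le> C \<and> (\<forall>f\<in>Lp p M. Lp_norm q N (T f) \<le> ennreal C * Lp_norm p M f))"

definition isometric_Lp ::
    "ennreal \<Rightarrow> 'a measure \<Rightarrow> ennreal \<Rightarrow> 'a measure \<Rightarrow> (('a \<Rightarrow> complex) \<Rightarrow> ('a \<Rightarrow> complex)) \<Rightarrow> bool"
  where "isometric_Lp p M q N T \<longleftrightarrow> (\<forall>f\<in>Lp p M. Lp_norm q N (T f) = Lp_norm p M f)"

text \<open>Between the spaces over \<open>restrict_space M E\<close> and \<open>restrict_space N E\<close> this is multiplication
  by the restriction of \<open>g\<close> to \<open>E\<close>, since values outside \<open>E\<close> are then irrelevant.\<close>

definition mult_op :: "('a \<Rightarrow> complex) \<Rightarrow> ('a \<Rightarrow> complex) \<Rightarrow> ('a \<Rightarrow> complex)"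
  where "mult_op g f = (\<lambda>x. g x * f x)"

definition is_atom :: "'a measure \<Rightarrow> 'a set \<Rightarrow> bool"
  where "is_atom M A \<longleftrightarrow> A \<in> sets M \<and> 0 < emeasure M A \<and>
    (\<forall>E\<in>sets M. E \<subseteq> A \<longrightarrow> emeasure M E = 0 \<or> emeasure M (A - E) = 0)"

text \<open>\<open>N = \<rho> \<cdot> M + Ns\<close>, with \<open>Ns\<close> concentrated on the \<open>M\<close>-null set \<open>S\<close>. Nonnegativity of the
  density is required only almost everywhere.\<close>

definition lebesgue_decomposition ::
    "'a measure \<Rightarrow> 'a measure \<Rightarrow> ('a \<Rightarrow> real) \<Rightarrow> 'a measure \<Rightarrow> 'a set \<Rightarrow> bool"
  where "lebesgue_decomposition M N \<rho> Ns S \<longleftrightarrow>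
    \<rho> \<in> borel_measurable M \<and> (AE x in M. 0 \<le> \<rho> x) \<and>
    sigma_finite_measure Ns \<and> sets Ns = sets M \<and>
    (\<forall>E\<in>sets M. emeasure N E = emeasure (density M (\<lambda>x. ennreal (\<rho> x))) E + emeasure Ns E) \<and>
    S \<in> sets M \<and> emeasure M S = 0 \<and> emeasure Ns (space M - S) = 0"

end

theory Submission
  imports Defs
begin

text \<open>
  The proof eliminates \<open>N\<close> and then solves a problem about the single measure \<open>M\<close>.

  On the \<open>M\<close>-null set \<open>S\<close> the symbol \<open>g\<close> vanishes \<open>N\<close>-almost everywhere: the
  indicator of \<open>S\<close> is the zero class of \<open>L\<^sub>p(M)\<close>, so a well-defined operator must send it to the
  zero class of \<open>L\<^sub>q(N)\<close>. Hence only \<open>C\<close> matters. This gives at once that the operator over the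
  whole space and the one over \<open>C\<close> are isometric together (\<open>isometric_restrict_space_iff\<close>).
  Since \<open>N\<close> has density \<open>\<rho>\<close> on \<open>C\<close>, it also gives
  \<open>\<parallel>g f\<parallel>\<^sub>q\<^sub>,\<^sub>N = \<parallel>h f\<parallel>\<^sub>q\<^sub>,\<^sub>M\<close> with \<open>h = g \<rho>\<^bsup>1/q\<^esup>\<close>
  (\<open>Lp_norm_lebesgue_decomposition\<close>). For \<open>q = \<infinity>\<close> the same formula holds because
  \<open>0 powr 0 = 0\<close>, so that \<open>\<rho> powr 0\<close> is the indicator of \<open>{\<rho> > 0}\<close>.

  It remains to see when multiplication by \<open>h\<close> is isometric from \<open>L\<^sub>p(M)\<close> to \<open>L\<^sub>q(M)\<close>
  (\<open>isometric_mult_iff\<close>). If \<open>M\<close> is not a single atom, there are two disjointly supported unit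
  vectors in \<open>L\<^sub>p(M)\<close>; their sum has norm \<open>2\<^bsup>1/p\<^esup>\<close>. Multiplication keeps the supports disjoint,
  so the image of the sum has norm \<open>2\<^bsup>1/q\<^esup>\<close>, and an isometry forces \<open>p = q\<close>. Next, put
  \<open>\<kappa> = M(\<Omega>)\<^bsup>1/p-1/q\<^esup>\<close>. Every set \<open>E\<close> of finite positive measure satisfies
  \<open>M(E)\<^bsup>1/p\<^esup> = \<kappa> M(E)\<^bsup>1/q\<^esup>\<close>, trivially if \<open>p = q\<close> and because \<open>M(E) = M(\<Omega>)\<close> if
  \<open>M\<close> is an atom. So \<open>h\<close> acts on the norm of every such indicator like the constant \<open>\<kappa>\<close>, and
  testing on subsets of \<open>{\<bar>h\<bar> > \<kappa>}\<close> and \<open>{\<bar>h\<bar> < \<kappa>}\<close> gives \<open>\<bar>h\<bar> = \<kappa>\<close> almost everywhere.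
  Conversely, if \<open>\<bar>h\<bar> = \<kappa>\<close> then \<open>\<parallel>h f\<parallel>\<^sub>q = \<kappa> \<parallel>f\<parallel>\<^sub>q\<close>, and on an atom every measurable
  function has constant modulus, so that \<open>\<parallel>f\<parallel>\<^sub>q\<close> and \<open>\<parallel>f\<parallel>\<^sub>p\<close> differ exactly by the factor
  \<open>\<kappa>\<close>. Positivity of \<open>\<rho>\<close> follows, since \<open>\<kappa> \<noteq> 0\<close>.
\<close>

section \<open>Powers and reciprocal exponents\<close>

lemma recip_infinity [simp]: "recip top = 0" "recip \<infinity> = 0"
  by (simp_all add: recip_def)

lemma exponent_real:
  assumes "1 \<le> p" "p \<noteq> \<infinity>"
  obtains r where "1 \<le> r" "p = ennreal r" "enn2real p = r" "recip p = 1 / r"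
proof -
  obtain r where r: "0 \<le> r" "p = ennreal r"
    using assms(2) by (cases p) auto
  have "1 \<le> r"
    using assms(1) r by (simp flip: ennreal_1)
  moreover have "recip p = 1 / r"
    using r \<open>1 \<le> r\<close> unfolding recip_def
    by (simp add: divide_ennreal flip: ennreal_1)
  ultimately show thesis
    using that r by simp
qed

lemma recip_nonneg [simp]: "0 \<le> recip p"
  by (simp add: recip_def)

lemma recip_eq_iff:
  assumes "1 \<le> p" "1 \<le> q"
  shows "recip p = recip q \<longleftrightarrow> p = q"
proof (cases "p = \<infinity> \<or> q = \<infinity>")
  case True
  then show ?thesis
    using assms by (metis exponent_real recip_infinity(2) divide_eq_0_iff not_one_le_zero zero_neq_one)
next
  case False
  then obtain r s where "p = ennreal r" "q = ennreal s" "recip p = 1 / r" "recip q = 1 / s"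
    "1 \<le> r" "1 \<le> s"
    using assms by (metis exponent_real)
  then show ?thesis by auto
qed

lemma epow_0 [simp]: "epow x 0 = 1"
  by (simp add: epow_def)

lemma epow_ennreal: "0 < t \<Longrightarrow> epow (ennreal t) a = ennreal (t powr a)"
  by (simp add: epow_def)

lemma ennreal_finite_pos_cases:
  fixes x :: ennreal
  assumes "x \<noteq> 0" "x \<noteq> \<infinity>"
  obtains t where "0 < t" "x = ennreal t"
  using assms by (cases x) (auto simp: less_le)

lemma epow_diff_mult:
  assumes "x \<noteq> 0" "x \<noteq> \<infinity>"
  shows "epow x (a - b) * epow x b = epow x a"
proof -
  obtain t where "0 < t" "x = ennreal t"
    using assms by (rule ennreal_finite_pos_cases)
  then show ?thesis
    by (simp add: epow_ennreal flip: ennreal_mult' powr_add)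
qed

lemma epow_mono:
  assumes "0 \<le> a" "x \<le> y"
  shows "epow x a \<le> epow y a"
proof (cases "a = 0 \<or> y = \<infinity> \<or> x = 0")
  case True
  then show ?thesis
    using assms by (auto simp: epow_def)
next
  case False
  then have "x \<noteq> \<infinity>" "y \<noteq> 0"
    using assms by (auto simp: top_unique)
  then show ?thesis
    using False assms
    by (auto simp: epow_def intro!: ennreal_leI powr_mono2 enn2real_mono simp: less_top)
qed

lemma epow_mult:
  assumes "0 \<le> a"
  shows "epow (x * y) a = epow x a * epow y a"
proof (cases "x = 0 \<or> y = 0 \<or> x = \<infinity> \<or> y = \<infinity>")
  case True
  then show ?thesis
    using assms
    by (auto simp: epow_def ennreal_mult_eq_top_iff ennreal_mult_top ennreal_top_mult enn2real_eq_0_iff)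
next
  case False
  then show ?thesis
    by (auto simp: epow_def ennreal_mult_eq_top_iff enn2real_mult powr_mult ennreal_mult')
qed

lemma epow_eq_1_iff:
  assumes "0 < a"
  shows "epow x a = 1 \<longleftrightarrow> x = 1"
proof (cases "x = 0 \<or> x = \<infinity>")
  case True
  then show ?thesis using assms by (auto simp: epow_def)
next
  case False
  then obtain t where "0 < t" "x = ennreal t"
    using ennreal_finite_pos_cases by metis
  then show ?thesis
    using assms by (simp add: epow_ennreal powr_def)
qed

lemma epow_powr_recip:
  assumes "1 \<le> p" "p \<noteq> \<infinity>" "0 \<le> t"
  shows "epow (ennreal (t powr enn2real p)) (recip p) = ennreal t"
proof -
  obtain r where r: "1 \<le> r" "enn2real p = r" "recip p = 1 / r"
    using assms(1,2) by (rule exponent_real)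
  show ?thesis
  proof (cases "t = 0")
    case True
    then show ?thesis using r by (simp add: epow_def)
  next
    case False
    then show ?thesis using r assms(3) by (simp add: epow_ennreal powr_powr)
  qed
qed

section \<open>The Lebesgue norm\<close>

lemma Lp_norm_mono:
  assumes [measurable]: "f \<in> borel_measurable M"
    and le: "AE x in M. cmod (f x) \<le> cmod (k x)"
  shows "Lp_norm p M f \<le> Lp_norm p M k"
proof (cases "p = \<infinity>")
  case True
  then show ?thesis
    using le by (auto simp: Lp_norm_def intro!: esssup_AE_mono)
next
  case False
  have "(\<integral>\<^sup>+ x. ennreal (cmod (f x) powr enn2real p) \<partial>M)
      \<le> (\<integral>\<^sup>+ x. ennreal (cmod (k x) powr enn2real p) \<partial>M)"
    using le by (intro nn_integral_mono_AE) (auto intro!: ennreal_leI powr_mono2)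
  then show ?thesis
    using False by (simp add: Lp_norm_def epow_mono)
qed

lemma Lp_norm_cong_AE:
  assumes "f \<in> borel_measurable M" "k \<in> borel_measurable M"
    and "AE x in M. cmod (f x) = cmod (k x)"
  shows "Lp_norm p M f = Lp_norm p M k"
  using assms by (intro antisym Lp_norm_mono) (auto elim: eventually_mono)

lemma Lp_norm_const:
  assumes p: "1 \<le> p" and M: "emeasure M (space M) \<noteq> 0"
  shows "Lp_norm p M (\<lambda>x. c) = ennreal (cmod c) * epow (emeasure M (space M)) (recip p)"
proof (cases "p = \<infinity>")
  case True
  then show ?thesis using M by (simp add: Lp_norm_def esssup_const)
next
  case False
  then show ?thesis
    using p by (simp add: Lp_norm_def epow_mult epow_powr_recip)
qed

lemma Lp_norm_scale:
  assumes p: "1 \<le> p" and [measurable]: "f \<in> borel_measurable M"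
  shows "Lp_norm p M (\<lambda>x. c * f x) = ennreal (cmod c) * Lp_norm p M f"
proof (cases "p = \<infinity>")
  case False
  have "(\<integral>\<^sup>+ x. ennreal (cmod (c * f x) powr enn2real p) \<partial>M)
      = ennreal (cmod c powr enn2real p) * (\<integral>\<^sup>+ x. ennreal (cmod (f x) powr enn2real p) \<partial>M)"
    by (simp add: norm_mult powr_mult ennreal_mult' nn_integral_cmult)
  then show ?thesis
    using False p by (simp add: Lp_norm_def epow_mult epow_powr_recip)
next
  case True
  \<comment> \<open>One inequality suffices: for \<open>c \<noteq> 0\<close> apply it to \<open>c\<close> and \<open>f\<close>, then to \<open>1/c\<close> and \<open>c f\<close>.\<close>
  have le: "esssup M (\<lambda>x. ennreal (cmod (d * u x))) \<le> ennreal (cmod d) * esssup M (\<lambda>x. ennreal (cmod (u x)))"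
    if [measurable]: "u \<in> borel_measurable M" for d and u :: "'a \<Rightarrow> complex"
    using esssup_AE[of "\<lambda>x. ennreal (cmod (u x))" M]
    by (intro esssup_I) (auto simp: norm_mult ennreal_mult' intro!: mult_left_mono elim!: eventually_mono)
  show ?thesis
  proof (cases "c = 0")
    case True
    then show ?thesis
      using le[of f 0] \<open>p = \<infinity>\<close> by (simp add: Lp_norm_def)
  next
    case False
    have "ennreal (cmod c) * esssup M (\<lambda>x. ennreal (cmod (f x)))
        = ennreal (cmod c) * esssup M (\<lambda>x. ennreal (cmod (inverse c * (c * f x))))"
      using False by (simp add: field_simps)
    also have "\<dots> \<le> ennreal (cmod c) * (ennreal (cmod (inverse c)) * esssup M (\<lambda>x. ennreal (cmod (c * f x))))"
      by (intro mult_left_mono le) auto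
    also have "\<dots> = esssup M (\<lambda>x. ennreal (cmod (c * f x)))"
      using False by (simp add: mult.assoc[symmetric] norm_inverse flip: ennreal_mult')
    finally show ?thesis
      using le[of f c] True by (auto simp: Lp_norm_def intro!: antisym)
  qed
qed

lemma Lp_norm_indicator:
  assumes p: "1 \<le> p" and E [measurable]: "E \<in> sets M" and pos: "emeasure M E \<noteq> 0"
  shows "Lp_norm p M (indicator E) = epow (emeasure M E) (recip p)"
proof (cases "p = \<infinity>")
  case False
  have "(\<integral>\<^sup>+ x. ennreal (cmod (indicator E x) powr enn2real p) \<partial>M) = (\<integral>\<^sup>+ x. indicator E x \<partial>M)"
    by (intro nn_integral_cong) (auto simp: indicator_def)
  then show ?thesis
    using False by (simp add: Lp_norm_def)
next
  case True
  have "1 \<le> z" if "AE x in M. ennreal (cmod (indicator E x)) \<le> z" for z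
  proof (rule ccontr)
    assume "\<not> 1 \<le> z"
    then have "AE x in M. x \<notin> E"
      using that by (auto elim!: eventually_mono simp: indicator_def split: if_splits)
    then show False
      using pos E by (simp add: AE_iff_measurable[OF E] sets.sets_into_space Int_absorb1 AE_not_in null_sets_def
          AE_iff_null_sets[OF E, symmetric])
  qed
  from this[OF esssup_AE] have "1 \<le> esssup M (\<lambda>x. ennreal (cmod (indicator E x)))" .
  moreover have "esssup M (\<lambda>x. ennreal (cmod (indicator E x))) \<le> 1"
    by (rule esssup_I) (auto simp: indicator_def)
  ultimately show ?thesis
    using True by (auto simp: Lp_norm_def intro!: antisym)
qed

text \<open>For finite \<open>p\<close> the \<open>p\<close>-th powers of the two moduli add up to an integral equal to 2; for
  \<open>p = \<infinity>\<close> the modulus of the sum is the maximum of the two moduli. The value \<open>2\<^bsup>1/p\<^esup>\<close> determines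
  \<open>p\<close>, and this is what separates the exponents.\<close>

lemma Lp_norm_add_disjoint_units:
  assumes p: "1 \<le> p"
    and [measurable]: "f \<in> borel_measurable M" "k \<in> borel_measurable M"
    and disj: "\<And>x. f x = 0 \<or> k x = 0"
    and f: "Lp_norm p M f = 1" and k: "Lp_norm p M k = 1"
  shows "Lp_norm p M (\<lambda>x. f x + k x) = ennreal (2 powr recip p)"
proof (cases "p = \<infinity>")
  case True
  let ?n = "\<lambda>u. esssup M (\<lambda>x. ennreal (cmod (u x)))"
  have "?n (\<lambda>x. f x + k x) \<le> 1"
  proof (rule esssup_I)
    have "AE x in M. ennreal (cmod (f x)) \<le> 1" "AE x in M. ennreal (cmod (k x)) \<le> 1"
      using esssup_AE[of "\<lambda>x. ennreal (cmod (f x))" M] esssup_AE[of "\<lambda>x. ennreal (cmod (k x))" M]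
        f k True by (simp_all add: Lp_norm_def)
    then show "AE x in M. ennreal (cmod (f x + k x)) \<le> 1"
    proof eventually_elim
      case (elim x)
      then show ?case using disj[of x] by auto
    qed
  qed measurable
  moreover have "Lp_norm p M f \<le> Lp_norm p M (\<lambda>x. f x + k x)"
  proof (rule Lp_norm_mono)
    have "cmod (f x) \<le> cmod (f x + k x)" for x
      using disj[of x] by auto
    then show "AE x in M. cmod (f x) \<le> cmod (f x + k x)" by simp
  qed measurable
  ultimately show ?thesis
    using True f by (auto simp: Lp_norm_def intro!: antisym)
next
  case False
  then obtain r where r: "1 \<le> r" "enn2real p = r" "recip p = 1 / r"
    using p by (metis exponent_real)
  let ?I = "\<lambda>u. \<integral>\<^sup>+ x. ennreal (cmod (u x) powr r) \<partial>M"
  have "?I (\<lambda>x. f x + k x) = (\<integral>\<^sup>+ x. ennreal (cmod (f x) powr r) + ennreal (cmod (k x) powr r) \<partial>M)"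
  proof (intro nn_integral_cong)
    fix x
    show "ennreal (cmod (f x + k x) powr r) = ennreal (cmod (f x) powr r) + ennreal (cmod (k x) powr r)"
      using disj[of x] by auto
  qed
  also have "\<dots> = ?I f + ?I k"
    by (intro nn_integral_add) measurable
  also have "?I f = 1"
    using f False r by (simp add: Lp_norm_def epow_eq_1_iff)
  also have "?I k = 1"
    using k False r by (simp add: Lp_norm_def epow_eq_1_iff)
  finally have "?I (\<lambda>x. f x + k x) = ennreal 2"
    by (simp add: one_add_one)
  then show ?thesis
    using False r epow_ennreal[of 2 "1 / r"] by (simp add: Lp_norm_def)
qed

lemma Lp_norm_restrict_space:
  assumes [measurable]: "C \<in> sets M" and f: "f \<in> borel_measurable (restrict_space M C)"
  shows "Lp_norm p (restrict_space M C) f = Lp_norm p M (\<lambda>x. indicator C x * f x)"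
proof -
  have C: "C \<inter> space M \<in> sets M" by simp
  have [measurable]: "(\<lambda>x. indicator C x * f x) \<in> borel_measurable M"
    using f by (simp add: borel_measurable_restrict_space_iff[OF C] scaleR_conv_of_real of_real_indicator)
  have [measurable]: "(\<lambda>x. ennreal (cmod (f x))) \<in> borel_measurable (restrict_space M C)"
    using f by measurable
  show ?thesis
  proof (cases "p = \<infinity>")
    case True
    have "(AE x in restrict_space M C. ennreal (cmod (f x)) \<le> z)
        \<longleftrightarrow> (AE x in M. ennreal (cmod (indicator C x * f x)) \<le> z)" for z
      by (auto simp: AE_restrict_space_iff[OF C] indicator_def elim!: eventually_mono)
    moreover have "(\<lambda>x. ennreal (cmod (f x))) \<in> borel_measurable (restrict_space M C)"
      "(\<lambda>x. ennreal (cmod (indicator C x * f x))) \<in> borel_measurable M"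
      by measurable
    ultimately show ?thesis
      unfolding True Lp_norm_def by (simp only: esssup_eq_AE if_True simp_thms)
  next
    case False
    have "(\<integral>\<^sup>+ x. ennreal (cmod (f x) powr enn2real p) \<partial>restrict_space M C)
        = (\<integral>\<^sup>+ x. ennreal (cmod (indicator C x * f x) powr enn2real p) \<partial>M)"
      unfolding nn_integral_restrict_space[OF C]
      by (intro nn_integral_cong) (auto simp: indicator_def)
    then show ?thesis
      using False by (simp add: Lp_norm_def)
  qed
qed

section \<open>Isometric multiplication over a single measure\<close>

lemma (in sigma_finite_measure) finite_positive_subset:
  assumes "W \<in> sets M" "emeasure M W \<noteq> 0"
  obtains E where "E \<in> sets M" "E \<subseteq> W" "emeasure M E \<noteq> 0" "emeasure M E \<noteq> \<infinity>"
proof (cases "emeasure M W = \<infinity>")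
  case True
  then show thesis
    using approx_PInf_emeasure_with_finite[OF assms(1), of 0] that
    by (metis ennreal_0 less_irrefl)
next
  case False
  then show thesis using that assms by blast
qed

text \<open>The set \<open>{u > c}\<close> is the countable union of the sets \<open>{u \<ge> c + 1/n}\<close>, so one of them is
  not null. The uniform gap between \<open>c\<close> and \<open>d\<close> survives the passage to norms of indicators.\<close>

lemma (in sigma_finite_measure) exceeds_on_finite_positive_set:
  fixes u :: "'a \<Rightarrow> real"
  assumes [measurable]: "u \<in> borel_measurable M" and "\<not> (AE x in M. u x \<le> c)"
  obtains d E where "c < d" "E \<in> sets M" "emeasure M E \<noteq> 0" "emeasure M E \<noteq> \<infinity>"
    "\<And>x. x \<in> E \<Longrightarrow> d \<le> u x"
proof -
  have "\<exists>n::nat. \<not> (AE x in M. u x < c + inverse (real (Suc n)))"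
  proof (rule ccontr)
    assume "\<not> ?thesis"
    then have "AE x in M. \<forall>n::nat. u x < c + inverse (real (Suc n))"
      by (simp add: AE_all_countable)
    then have "AE x in M. u x \<le> c"
    proof eventually_elim
      case (elim x)
      show ?case
      proof (rule ccontr)
        assume "\<not> u x \<le> c"
        then obtain n where "inverse (real (Suc n)) < u x - c"
          using reals_Archimedean[of "u x - c"] by auto
        then show False using elim[rule_format, of n] by simp
      qed
    qed
    then show False using assms(2) by simp
  qed
  then obtain n :: nat where n: "\<not> (AE x in M. u x < c + inverse (real (Suc n)))" by blast
  let ?d = "c + inverse (real (Suc n))"
  let ?W = "{x \<in> space M. ?d \<le> u x}"
  have W: "?W \<in> sets M" by measurable
  have "emeasure M ?W \<noteq> 0"
    using n by (subst (asm) AE_iff_measurable[OF W]) (auto simp: not_less)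
  then obtain E where "E \<in> sets M" "E \<subseteq> ?W" "emeasure M E \<noteq> 0" "emeasure M E \<noteq> \<infinity>"
    by (rule finite_positive_subset[OF W])
  moreover have "c < ?d" by simp
  ultimately show thesis
    using that[of ?d E] by blast
qed

text \<open>If \<open>\<bar>h\<bar> \<ge> d > c\<close> on a set \<open>E\<close> of finite positive measure, then \<open>h\<close> times the indicator
  of \<open>E\<close> has norm at least \<open>d M(E)\<^bsup>1/q\<^esup>\<close>, which exceeds the prescribed value. The lower bound for
  \<open>\<bar>h\<bar>\<close> is the same argument for \<open>-\<bar>h\<bar>\<close> and \<open>-c\<close>.\<close>

lemma (in sigma_finite_measure) modulus_eq_const_from_indicators:
  assumes q: "1 \<le> q" and [measurable]: "h \<in> borel_measurable M" and c: "0 \<le> c"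
    and ind: "\<And>E. E \<in> sets M \<Longrightarrow> emeasure M E \<noteq> 0 \<Longrightarrow> emeasure M E \<noteq> \<infinity> \<Longrightarrow>
      Lp_norm q M (\<lambda>x. h x * indicator E x) = ennreal c * epow (emeasure M E) (recip q)"
  shows "AE x in M. cmod (h x) = c"
proof -
  have "AE x in M. cmod (h x) \<le> c"
  proof (rule ccontr)
    assume *: "\<not> ?thesis"
    have "(\<lambda>x. cmod (h x)) \<in> borel_measurable M" by measurable
    from this * obtain d E where d: "c < d" and E [measurable]: "E \<in> sets M"
      and mE: "emeasure M E \<noteq> 0" "emeasure M E \<noteq> \<infinity>" and le: "\<And>x. x \<in> E \<Longrightarrow> d \<le> cmod (h x)"
      by (rule exceeds_on_finite_positive_set) blast
    obtain t where t: "0 < t" "emeasure M E = ennreal t"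
      using mE by (rule ennreal_finite_pos_cases)
    have "ennreal d * epow (emeasure M E) (recip q) = Lp_norm q M (\<lambda>x. of_real d * indicator E x)"
      using d c by (simp add: Lp_norm_scale q Lp_norm_indicator mE)
    also have "\<dots> \<le> Lp_norm q M (\<lambda>x. h x * indicator E x)"
      using d c le by (intro Lp_norm_mono) (auto simp: indicator_def)
    also have "\<dots> = ennreal c * epow (emeasure M E) (recip q)"
      using mE by (intro ind) auto
    finally show False
      using t d c by (simp add: epow_ennreal flip: ennreal_mult')
  qed
  moreover have "AE x in M. - cmod (h x) \<le> - c"
  proof (rule ccontr)
    assume *: "\<not> ?thesis"
    have "(\<lambda>x. - cmod (h x)) \<in> borel_measurable M" by measurable
    from this * obtain d E where d: "- c < d" and E [measurable]: "E \<in> sets M"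
      and mE: "emeasure M E \<noteq> 0" "emeasure M E \<noteq> \<infinity>" and le: "\<And>x. x \<in> E \<Longrightarrow> d \<le> - cmod (h x)"
      by (rule exceeds_on_finite_positive_set) blast
    obtain t where t: "0 < t" "emeasure M E = ennreal t"
      using mE by (rule ennreal_finite_pos_cases)
    have "E \<noteq> {}" using mE by auto
    then obtain x where "x \<in> E" by blast
    with le[of x] have d0: "d \<le> 0" using norm_ge_zero[of "h x"] by linarith
    have "ennreal c * epow (emeasure M E) (recip q) = Lp_norm q M (\<lambda>x. h x * indicator E x)"
      using mE by (intro ind[symmetric]) auto
    also have "\<dots> \<le> Lp_norm q M (\<lambda>x. of_real d * indicator E x)"
      using d0 le by (intro Lp_norm_mono) (force simp: indicator_def)+
    also have "\<dots> = ennreal (- d) * epow (emeasure M E) (recip q)"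
      using d0 by (simp add: Lp_norm_scale q Lp_norm_indicator mE)
    finally have "c * t powr recip q \<le> - d * t powr recip q"
      using t d0 c by (simp add: epow_ennreal ennreal_le_iff mult_nonpos_nonneg flip: ennreal_mult')
    moreover have "0 < (c + d) * t powr recip q"
      using t d by (intro mult_pos_pos) auto
    ultimately show False
      by (simp add: algebra_simps)
  qed
  ultimately show ?thesis
    by eventually_elim simp
qed

lemma (in sigma_finite_measure) emeasure_atom_finite:
  assumes "is_atom M A"
  shows "emeasure M A \<noteq> \<infinity>"
proof
  assume inf: "emeasure M A = \<infinity>"
  have A: "A \<in> sets M" using assms by (simp add: is_atom_def)
  then obtain E where E: "E \<in> sets M" "E \<subseteq> A" "emeasure M E \<noteq> 0" "emeasure M E \<noteq> \<infinity>"
    using finite_positive_subset[of A] inf by auto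
  then have "emeasure M (A - E) = 0"
    using assms by (auto simp: is_atom_def)
  moreover have "emeasure M (A - E) = emeasure M A - emeasure M E"
    using E A by (intro emeasure_Diff) auto
  ultimately show False
    using inf E by (simp add: ennreal_top_minus)
qed

text \<open>Below the essential supremum every superlevel set has positive measure, hence is all of the
  atom up to a null set; so the modulus is almost everywhere at least its essential supremum.\<close>

lemma atom_modulus_eq_esssup:
  assumes atom: "is_atom M (space M)" and [measurable]: "f \<in> borel_measurable M"
  shows "AE x in M. ennreal (cmod (f x)) = esssup M (\<lambda>x. ennreal (cmod (f x)))"
    (is "AE x in M. ?u x = ?c")
proof -
  have above: "AE x in M. z < ?u x" if "z < ?c" for z
  proof -
    let ?E = "{x \<in> space M. z < ?u x}"
    have E: "?E \<in> sets M" by measurable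
    have "emeasure M ?E \<noteq> 0"
      using esssup_pos_measure[OF _ that] by simp
    then have "emeasure M (space M - ?E) = 0"
      using atom E unfolding is_atom_def by (metis sets.sets_into_space)
    then show ?thesis
      using E by (intro AE_I[of _ _ "space M - ?E"]) auto
  qed
  have "AE x in M. ?c \<le> ?u x"
  proof (cases "?c = 0")
    case False
    then obtain v where v: "\<And>n::nat. v n < ?c" "v \<longlonglongrightarrow> ?c"
      using approx_from_below_dense_linorder[of 0 ?c] by (auto simp: zero_less_iff_neq_zero)
    have "AE x in M. \<forall>n. v n < ?u x"
      using above v(1) by (simp add: AE_all_countable)
    then show ?thesis
      by eventually_elim (use v(2) in \<open>blast intro: LIMSEQ_le_const2 less_imp_le\<close>)
  qed simp
  moreover have "AE x in M. ?u x \<le> ?c" by (rule esssup_AE)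
  ultimately show ?thesis by eventually_elim simp
qed

text \<open>On an atom \<open>\<parallel>f\<parallel>\<^sub>p\<close> depends on \<open>p\<close> only through a power of the total mass, since
  \<open>\<bar>f\<bar>\<close> is constant there.\<close>

lemma atom_Lp_norm:
  assumes atom: "is_atom M (space M)" and p: "1 \<le> p" and [measurable]: "f \<in> borel_measurable M"
  shows "Lp_norm p M f = Lp_norm \<infinity> M f * epow (emeasure M (space M)) (recip p)"
proof -
  let ?c = "esssup M (\<lambda>x. ennreal (cmod (f x)))"
  have pos: "emeasure M (space M) \<noteq> 0"
    using atom by (auto simp: is_atom_def)
  have ae: "AE x in M. ennreal (cmod (f x)) = ?c"
    using atom by (rule atom_modulus_eq_esssup) measurable
  have "?c \<noteq> \<infinity>"
  proof
    assume "?c = \<infinity>"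
    with ae have "AE x in M. False" by simp
    then show False using pos by (simp add: AE_iff_measurable[OF _ refl])
  qed
  then obtain t where t: "0 \<le> t" "?c = ennreal t"
    by (cases ?c) auto
  have "Lp_norm p M f = Lp_norm p M (\<lambda>x. of_real t)"
    using ae t by (intro Lp_norm_cong_AE) (auto elim!: eventually_mono)
  also have "\<dots> = ennreal t * epow (emeasure M (space M)) (recip p)"
    using t by (simp add: Lp_norm_const p pos)
  finally show ?thesis
    using t by (simp add: Lp_norm_def)
qed

text \<open>A space that is not an atom splits into two pieces of positive measure. They carry disjointly
  supported unit vectors, and their sum has norm \<open>2\<^bsup>1/p\<^esup>\<close> before and \<open>2\<^bsup>1/q\<^esup>\<close> after the isometry.\<close>

lemma (in sigma_finite_measure) isometric_imp_atom:
  assumes p: "1 \<le> p" and q: "1 \<le> q" and "p \<noteq> q"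
    and [measurable]: "h \<in> borel_measurable M"
    and nontrivial: "emeasure M (space M) \<noteq> 0"
    and iso: "isometric_Lp p M q M (mult_op h)"
  shows "is_atom M (space M)"
proof (rule ccontr)
  assume "\<not> ?thesis"
  then obtain W where W: "W \<in> sets M" "emeasure M W \<noteq> 0" "emeasure M (space M - W) \<noteq> 0"
    using nontrivial by (auto simp: is_atom_def zero_less_iff_neq_zero)
  \<comment> \<open>A suitable multiple of the indicator of a subset of finite positive measure.\<close>
  have unit: "\<exists>f \<in> borel_measurable M. Lp_norm p M f = 1 \<and> (\<forall>x. x \<notin> V \<longrightarrow> f x = 0)"
    if V: "V \<in> sets M" "emeasure M V \<noteq> 0" for V
  proof -
    obtain E where E [measurable]: "E \<in> sets M" and EV: "E \<subseteq> V"
      and mE: "emeasure M E \<noteq> 0" "emeasure M E \<noteq> \<infinity>"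
      using V by (rule finite_positive_subset)
    obtain t where t: "0 < t" "emeasure M E = ennreal t"
      using mE by (rule ennreal_finite_pos_cases)
    let ?f = "\<lambda>x. of_real (t powr - recip p) * indicator E x :: complex"
    have "Lp_norm p M ?f = 1"
      using t by (simp add: Lp_norm_scale p Lp_norm_indicator mE epow_ennreal
          flip: ennreal_mult' powr_add del: of_real_indicator)
    moreover have "?f \<in> borel_measurable M" by measurable
    ultimately show ?thesis
      using EV by (intro bexI[of _ ?f]) (auto simp: indicator_def)
  qed
  obtain f where [measurable]: "f \<in> borel_measurable M" and f: "Lp_norm p M f = 1"
    and f0: "\<And>x. x \<notin> W \<Longrightarrow> f x = 0"
    using unit[OF W(1,2)] by blast
  obtain k where [measurable]: "k \<in> borel_measurable M" and k: "Lp_norm p M k = 1"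
    and k0: "\<And>x. x \<notin> space M - W \<Longrightarrow> k x = 0"
    using unit[of "space M - W"] W by blast
  have disj: "f x = 0 \<or> k x = 0" for x
    using f0 k0 by blast
  have sum: "Lp_norm p M (\<lambda>x. f x + k x) = ennreal (2 powr recip p)"
    using p disj f k by (intro Lp_norm_add_disjoint_units) measurable
  have isoD: "Lp_norm q M (\<lambda>x. h x * u x) = Lp_norm p M u"
    if "u \<in> borel_measurable M" "Lp_norm p M u < \<infinity>" for u
    using iso that by (auto simp: isometric_Lp_def mult_op_def Lp_def)
  have "Lp_norm q M (\<lambda>x. h x * f x + h x * k x) = ennreal (2 powr recip q)"
    using q disj f k by (intro Lp_norm_add_disjoint_units) (auto simp: isoD)
  moreover have "Lp_norm q M (\<lambda>x. h x * (f x + k x)) = ennreal (2 powr recip p)"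
    using sum by (subst isoD) auto
  ultimately have "recip p = recip q"
    by (simp add: distrib_left powr_inj)
  then show False
    using p q \<open>p \<noteq> q\<close> by (simp add: recip_eq_iff)
qed

text \<open>In the isometric case the cases \<open>p = q\<close> and \<open>p \<noteq> q\<close> both lead to the identity
  \<open>M(E)\<^bsup>1/p\<^esup> = \<kappa> M(E)\<^bsup>1/q\<^esup>\<close> for sets of finite positive measure, where \<open>\<kappa>\<close> is the value on
  the right-hand side below: for \<open>p = q\<close> it is 1, and otherwise \<open>E\<close> fills the atom.\<close>

lemma (in sigma_finite_measure) isometric_mult_iff:
  assumes p: "1 \<le> p" and q: "1 \<le> q"
    and [measurable]: "h \<in> borel_measurable M"
    and nontrivial: "p \<noteq> q \<Longrightarrow> emeasure M (space M) \<noteq> 0"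
  shows "isometric_Lp p M q M (mult_op h) \<longleftrightarrow>
    (AE x in M. ennreal (cmod (h x)) = epow (emeasure M (space M)) (recip p - recip q)) \<and>
    (p \<noteq> q \<longrightarrow> is_atom M (space M))"
proof -
  let ?m = "emeasure M (space M)"
  let ?k = "epow ?m (recip p - recip q)"
  have mass: "?m \<noteq> 0" "?m \<noteq> \<infinity>" if "p \<noteq> q" "is_atom M (space M)"
    using that nontrivial emeasure_atom_finite by auto
  have const: "\<exists>c>0. ?k = ennreal c" if atom: "p \<noteq> q \<longrightarrow> is_atom M (space M)"
  proof (cases "p = q")
    case False
    then obtain t where "0 < t" "?m = ennreal t"
      using mass atom ennreal_finite_pos_cases by metis
    then show ?thesis
      by (auto simp: epow_ennreal intro!: exI[of _ "t powr (recip p - recip q)"])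
  qed (auto intro!: exI[of _ 1])
  show ?thesis
  proof (intro iffI conjI)
    assume iso: "isometric_Lp p M q M (mult_op h)"
    show atom: "p \<noteq> q \<longrightarrow> is_atom M (space M)"
      using isometric_imp_atom[OF p q _ _ nontrivial iso] by simp
    then obtain c where c: "0 < c" "?k = ennreal c"
      using const by blast
    have "AE x in M. cmod (h x) = c"
    proof (rule modulus_eq_const_from_indicators[OF q])
      fix E assume E [measurable]: "E \<in> sets M" and mE: "emeasure M E \<noteq> 0" "emeasure M E \<noteq> \<infinity>"
      have "Lp_norm p M (indicator E) < \<infinity>"
        using mE by (auto simp: Lp_norm_indicator p epow_ennreal elim!: ennreal_finite_pos_cases)
      then have "Lp_norm q M (\<lambda>x. h x * indicator E x) = Lp_norm p M (indicator E)"
        using iso E by (auto simp: isometric_Lp_def mult_op_def Lp_def)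
      also have "\<dots> = epow (emeasure M E) (recip p)"
        using mE by (simp add: Lp_norm_indicator p)
      also have "\<dots> = ?k * epow (emeasure M E) (recip q)"
      proof (cases "p = q")
        case False
        \<comment> \<open>In an atom every set of positive measure has full measure.\<close>
        have "emeasure M (space M - E) = 0"
          using atom False E mE(1) sets.sets_into_space[OF E] unfolding is_atom_def by blast
        then have "emeasure M E = ?m"
          using emeasure_Diff_null_set[of "space M - E" M "space M"] E sets.sets_into_space[OF E]
          by (simp add: null_sets_def double_diff)
        then show ?thesis
          using mE by (simp add: epow_diff_mult)
      qed simp
      finally show "Lp_norm q M (\<lambda>x. h x * indicator E x) = ennreal c * epow (emeasure M E) (recip q)"
        using c by simp
    qed (use c in auto)
    then show "AE x in M. ennreal (cmod (h x)) = ?k"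
      using c by simp
  next
    assume *: "(AE x in M. ennreal (cmod (h x)) = ?k) \<and> (p \<noteq> q \<longrightarrow> is_atom M (space M))"
    then obtain c where c: "0 < c" "?k = ennreal c"
      using const by blast
    show "isometric_Lp p M q M (mult_op h)"
      unfolding isometric_Lp_def
    proof
      fix f assume "f \<in> Lp p M"
      then have [measurable]: "f \<in> borel_measurable M" by (simp add: Lp_def)
      have "Lp_norm q M (mult_op h f) = Lp_norm q M (\<lambda>x. of_real c * f x)"
        unfolding mult_op_def using * c
        by (intro Lp_norm_cong_AE) (auto simp: norm_mult elim!: eventually_mono)
      also have "\<dots> = ?k * Lp_norm q M f"
        using c by (simp add: Lp_norm_scale q)
      also have "\<dots> = Lp_norm p M f"
      proof (cases "p = q")
        case False
        then have "is_atom M (space M)" using * by blast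
        then show ?thesis
          using mass[OF False]
          by (simp add: atom_Lp_norm[of M p f] atom_Lp_norm[of M q f] p q mult.left_commute epow_diff_mult)
      qed simp
      finally show "Lp_norm q M (mult_op h f) = Lp_norm p M f" .
    qed
  qed
qed

section \<open>Passing from the second measure to the first\<close>

text \<open>Cutting \<open>N\<close> down to the complement of \<open>S\<close> removes the singular part.\<close>

lemma density_complement_eq:
  assumes sets: "sets N = sets M" and dec: "lebesgue_decomposition M N \<rho> Ns S"
  shows "density N (indicator (space M - S)) = density M (\<lambda>x. ennreal (\<rho> x))"
proof (rule measure_eqI)
  show "sets (density N (indicator (space M - S))) = sets (density M (\<lambda>x. ennreal (\<rho> x)))"
    using sets by simp
  fix E assume "E \<in> sets (density N (indicator (space M - S)))"
  then have E [measurable]: "E \<in> sets M" using sets by simp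
  have [measurable]: "\<rho> \<in> borel_measurable M" "S \<in> sets M"
    using dec by (auto simp: lebesgue_decomposition_def)
  have sNs: "sets Ns = sets M" using dec by (auto simp: lebesgue_decomposition_def)
  let ?E = "(space M - S) \<inter> E"
  have [measurable]: "?E \<in> sets M" "?E \<in> sets N" using sets by auto
  have "emeasure (density N (indicator (space M - S))) E = emeasure N ?E"
    using sets by (simp add: emeasure_density flip: indicator_inter_arith)
  also have "\<dots> = emeasure (density M (\<lambda>x. ennreal (\<rho> x))) ?E + emeasure Ns ?E"
    using dec by (simp add: lebesgue_decomposition_def)
  also have "emeasure Ns ?E = 0"
    using dec emeasure_mono[of ?E "space M - S" Ns] sNs by (auto simp: lebesgue_decomposition_def)
  also have "emeasure (density M (\<lambda>x. ennreal (\<rho> x))) ?E = emeasure (density M (\<lambda>x. ennreal (\<rho> x))) E"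
  proof -
    have "AE x in M. x \<notin> S"
      using dec by (intro AE_not_in) (auto simp: lebesgue_decomposition_def null_sets_def)
    then have "AE x in M. ennreal (\<rho> x) * indicator ?E x = ennreal (\<rho> x) * indicator E x"
      using AE_space by eventually_elim (simp add: indicator_def)
    then show ?thesis
      by (auto simp: emeasure_density intro!: nn_integral_cong_AE)
  qed
  finally show "emeasure (density N (indicator (space M - S))) E = emeasure (density M (\<lambda>x. ennreal (\<rho> x))) E"
    by simp
qed

text \<open>For finite \<open>q\<close> the density moves into the \<open>q\<close>-th power. For \<open>q = \<infinity>\<close> only null sets count:
  those of \<open>N\<close> off \<open>S\<close> are the \<open>M\<close>-null sets of \<open>{\<rho> > 0}\<close>, and \<open>\<rho> powr 0\<close> is the indicator of
  that set.\<close>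

lemma Lp_norm_lebesgue_decomposition:
  assumes sets: "sets N = sets M" and dec: "lebesgue_decomposition M N \<rho> Ns S"
    and q: "1 \<le> q" and k: "k \<in> borel_measurable M"
    and zero: "AE x in N. x \<in> S \<longrightarrow> k x = 0"
  shows "Lp_norm q N k = Lp_norm q M (\<lambda>x. of_real (\<rho> x powr recip q) * k x)"
proof -
  have [measurable]: "\<rho> \<in> borel_measurable M" "S \<in> sets M" "S \<in> sets N"
    and nonneg: "AE x in M. 0 \<le> \<rho> x"
    using dec sets by (auto simp: lebesgue_decomposition_def)
  have [measurable]: "k \<in> borel_measurable M" "k \<in> borel_measurable N"
    using k by (auto cong: measurable_cong_sets simp: sets measurable_cong_sets[OF sets refl])
  have sp: "space N = space M" using sets by (rule sets_eq_imp_space_eq)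
  have Cm [measurable]: "space M - S \<in> sets N" using sets by simp
  note dens = density_complement_eq[OF sets dec]
  show ?thesis
  proof (cases "q = \<infinity>")
    case True
    have "(AE x in N. ennreal (cmod (k x)) \<le> z) \<longleftrightarrow>
        (AE x in M. ennreal (cmod (of_real (\<rho> x powr 0) * k x)) \<le> z)" for z
    proof -
      have "(AE x in N. ennreal (cmod (k x)) \<le> z) \<longleftrightarrow>
          (AE x in N. x \<notin> S \<longrightarrow> ennreal (cmod (k x)) \<le> z)"
        using zero by (intro eventually_subst) (auto elim!: eventually_mono)
      also have "\<dots> \<longleftrightarrow> (AE x in N. 0 < (indicator (space M - S) x :: ennreal) \<longrightarrow> ennreal (cmod (k x)) \<le> z)"
        by (intro AE_cong) (auto simp: indicator_def sp)
      also have "\<dots> \<longleftrightarrow> (AE x in density N (indicator (space M - S)). ennreal (cmod (k x)) \<le> z)"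
        by (simp add: AE_density)
      also have "\<dots> \<longleftrightarrow> (AE x in M. 0 < \<rho> x \<longrightarrow> ennreal (cmod (k x)) \<le> z)"
        unfolding dens by (subst AE_density) auto
      also have "\<dots> \<longleftrightarrow> (AE x in M. ennreal (cmod (of_real (\<rho> x powr 0) * k x)) \<le> z)"
        using nonneg by (intro eventually_subst) (auto elim!: eventually_mono simp: norm_mult)
      finally show ?thesis .
    qed
    then show ?thesis
      using True by (simp add: Lp_norm_def esssup_eq_AE)
  next
    case False
    then obtain r where r: "1 \<le> r" "enn2real q = r" "recip q = 1 / r"
      using q by (metis exponent_real)
    have "(\<integral>\<^sup>+ x. ennreal (cmod (k x) powr r) \<partial>N)
        = (\<integral>\<^sup>+ x. indicator (space M - S) x * ennreal (cmod (k x) powr r) \<partial>N)"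
    proof (rule nn_integral_cong_AE)
      show "AE x in N. ennreal (cmod (k x) powr r)
          = indicator (space M - S) x * ennreal (cmod (k x) powr r)"
        using zero AE_space by eventually_elim (auto simp: indicator_def sp)
    qed
    also have "\<dots> = (\<integral>\<^sup>+ x. ennreal (cmod (k x) powr r) \<partial>density N (indicator (space M - S)))"
      by (subst nn_integral_density) auto
    also have "\<dots> = (\<integral>\<^sup>+ x. ennreal (\<rho> x) * ennreal (cmod (k x) powr r) \<partial>M)"
      unfolding dens by (subst nn_integral_density) auto
    also have "\<dots> = (\<integral>\<^sup>+ x. ennreal (cmod (of_real (\<rho> x powr recip q) * k x) powr r) \<partial>M)"
    proof (rule nn_integral_cong_AE)
      show "AE x in M. ennreal (\<rho> x) * ennreal (cmod (k x) powr r)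
          = ennreal (cmod (of_real (\<rho> x powr recip q) * k x) powr r)"
        using nonneg
        by eventually_elim (use r in \<open>auto simp: norm_mult powr_mult powr_powr simp flip: ennreal_mult'\<close>)
    qed
    finally show ?thesis
      using False r by (simp add: Lp_norm_def)
  qed
qed

text \<open>The indicator of \<open>S\<close> and the function 0 represent the same class of \<open>L\<^sub>p(M)\<close>, so \<open>g\<close> times
  the indicator must represent 0 in \<open>L\<^sub>q(N)\<close>.\<close>

lemma well_defined_imp_zero_on_null:
  assumes wd: "well_defined_Lp p M q N (mult_op g)" and p: "1 \<le> p"
    and S [measurable]: "S \<in> sets M" and null: "emeasure M S = 0"
  shows "AE x in N. x \<in> S \<longrightarrow> g x = 0"
proof -
  have ae: "AE x in M. indicator S x = (0::complex)"
  proof -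
    have "AE x in M. x \<notin> S" using S null by (intro AE_not_in) auto
    then show ?thesis by eventually_elim simp
  qed
  have "Lp_norm p M (\<lambda>x. 0) = 0"
    using Lp_norm_scale[OF p, of "\<lambda>x. 0" M 0] by simp
  moreover have "Lp_norm p M (indicator S) = Lp_norm p M (\<lambda>x. 0)"
    using ae by (intro Lp_norm_cong_AE) (auto elim!: eventually_mono)
  ultimately have "indicator S \<in> Lp p M" "(\<lambda>x. 0) \<in> Lp p M"
    by (auto simp: Lp_def)
  then have "AE x in N. mult_op g (indicator S) x = mult_op g (\<lambda>x. 0) x"
    using wd[unfolded well_defined_Lp_def, THEN conjunct2, rule_format, OF _ _ ae] by simp
  then show ?thesis
    by eventually_elim (auto simp: mult_op_def)
qed

text \<open>Restriction to \<open>C\<close> and extension by 0 identify \<open>L\<^sub>p(M)\<close> with the space over \<open>C\<close>. On the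
  target side the part of \<open>N\<close> outside \<open>C\<close> need not be null, but the product with \<open>g\<close> vanishes there.\<close>

lemma isometric_restrict_space_iff:
  assumes sets: "sets N = sets M" and C [measurable]: "C \<in> sets M"
    and null: "emeasure M (space M - C) = 0"
    and g: "g \<in> borel_measurable M" and zero: "AE x in N. x \<notin> C \<longrightarrow> g x = 0"
  shows "isometric_Lp p (restrict_space M C) q (restrict_space N C) (mult_op g)
    \<longleftrightarrow> isometric_Lp p M q N (mult_op g)"
proof -
  have CN [measurable]: "C \<in> sets N" using sets by simp
  have Ci: "C \<inter> space M \<in> sets M" by simp
  have meas: "borel_measurable N = (borel_measurable M :: ('a \<Rightarrow> complex) set)"
    using sets by (rule measurable_cong_sets) simp
  have gN [measurable]: "g \<in> borel_measurable M" "g \<in> borel_measurable N" using g meas by auto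
  have ext_meas: "(\<lambda>x. indicator C x * f x) \<in> borel_measurable M"
    if "f \<in> borel_measurable (restrict_space M C)" for f :: "'a \<Rightarrow> complex"
    using that by (simp add: borel_measurable_restrict_space_iff[OF Ci] scaleR_conv_of_real of_real_indicator)
  have rmeas: "borel_measurable (restrict_space N C) = (borel_measurable (restrict_space M C) :: ('a \<Rightarrow> complex) set)"
    using sets by (intro measurable_cong_sets sets_restrict_space_cong) auto
  have target: "Lp_norm q (restrict_space N C) (mult_op g f) = Lp_norm q N (mult_op g (\<lambda>x. indicator C x * f x))"
    if f: "f \<in> borel_measurable (restrict_space M C)" for f
  proof -
    have "g \<in> borel_measurable (restrict_space M C)"
      using g by (rule measurable_restrict_space1)
    then have "mult_op g f \<in> borel_measurable (restrict_space N C)"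
      using f unfolding mult_op_def rmeas by measurable
    then show ?thesis
      by (simp add: Lp_norm_restrict_space mult_op_def mult.left_commute)
  qed
  have aeC: "AE x in M. x \<in> C"
  proof -
    have "AE x in M. x \<notin> space M - C" using null by (intro AE_not_in) auto
    then show ?thesis using AE_space by eventually_elim auto
  qed
  show ?thesis
  proof
    assume iso: "isometric_Lp p (restrict_space M C) q (restrict_space N C) (mult_op g)"
    show "isometric_Lp p M q N (mult_op g)"
      unfolding isometric_Lp_def
    proof
      fix f assume f: "f \<in> Lp p M"
      then have [measurable]: "f \<in> borel_measurable M" "f \<in> borel_measurable N"
        using meas by (auto simp: Lp_def)
      have fr: "f \<in> borel_measurable (restrict_space M C)"
        by (intro measurable_restrict_space1) measurable
      have "Lp_norm p M (\<lambda>x. indicator C x * f x) = Lp_norm p M f"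
        using aeC by (intro Lp_norm_cong_AE) (auto elim!: eventually_mono)
      then have norm: "Lp_norm p (restrict_space M C) f = Lp_norm p M f"
        using fr by (simp add: Lp_norm_restrict_space)
      have "Lp_norm q N (mult_op g f) = Lp_norm q N (mult_op g (\<lambda>x. indicator C x * f x))"
        unfolding mult_op_def using zero
        by (intro Lp_norm_cong_AE) (auto elim!: eventually_mono simp: indicator_def)
      also have "\<dots> = Lp_norm q (restrict_space N C) (mult_op g f)"
        using target[OF fr] by simp
      also have "\<dots> = Lp_norm p (restrict_space M C) f"
        using iso f fr norm by (auto simp: isometric_Lp_def Lp_def)
      finally show "Lp_norm q N (mult_op g f) = Lp_norm p M f"
        using norm by simp
    qed
  next
    assume iso: "isometric_Lp p M q N (mult_op g)"
    show "isometric_Lp p (restrict_space M C) q (restrict_space N C) (mult_op g)"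
      unfolding isometric_Lp_def
    proof
      fix f assume f: "f \<in> Lp p (restrict_space M C)"
      then have fr: "f \<in> borel_measurable (restrict_space M C)" by (simp add: Lp_def)
      have norm: "Lp_norm p (restrict_space M C) f = Lp_norm p M (\<lambda>x. indicator C x * f x)"
        using fr by (simp add: Lp_norm_restrict_space)
      then have "(\<lambda>x. indicator C x * f x) \<in> Lp p M"
        using f ext_meas[OF fr] by (simp add: Lp_def)
      then show "Lp_norm q (restrict_space N C) (mult_op g f) = Lp_norm p (restrict_space M C) f"
        using iso by (simp add: target[OF fr] norm isometric_Lp_def)
    qed
  qed
qed

theorem theorem2p2p3:
  fixes M N Ns :: "'a measure" and p q :: ennreal and g :: "'a \<Rightarrow> complex"
    and \<rho> :: "'a \<Rightarrow> real" and S C :: "'a set"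
  assumes "sigma_finite_measure M" and "sigma_finite_measure N" and "sets N = sets M"
    and "1 \<le> p" and "1 \<le> q"
    and "g \<in> borel_measurable M"
    and "well_defined_Lp p M q N (mult_op g)"
    and "bounded_Lp p M q N (mult_op g)"
    and "lebesgue_decomposition M N \<rho> Ns S"
    and "C = space M - S"
    and nontrivial: "p \<noteq> q \<Longrightarrow> emeasure M (space M) \<noteq> 0"
  defines "i \<equiv> isometric_Lp p M q N (mult_op g)"
    and "ii \<equiv> isometric_Lp p (restrict_space M C) q (restrict_space N C) (mult_op g)"
    and "iii \<equiv> (AE x in M. 0 < \<rho> x) \<and>
      (AE x\<in>C in M. ennreal (cmod (g x * complex_of_real (\<rho> x powr recip q)))
                      = epow (emeasure M C) (recip p - recip q)) \<and>
      (p \<noteq> q \<longrightarrow> is_atom M (space M))"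
  shows "(i \<longleftrightarrow> ii) \<and> (ii \<longleftrightarrow> iii)"
proof -
  interpret sigma_finite_measure M by fact
  note sets = \<open>sets N = sets M\<close> and dec = \<open>lebesgue_decomposition M N \<rho> Ns S\<close>
  have [measurable]: "g \<in> borel_measurable M" by fact
  have [measurable]: "\<rho> \<in> borel_measurable M" "S \<in> sets M" and nonneg: "AE x in M. 0 \<le> \<rho> x"
    and null: "emeasure M S = 0"
    using dec by (auto simp: lebesgue_decomposition_def)
  have C [measurable]: "C \<in> sets M" using \<open>C = space M - S\<close> by simp
  have SC: "space M - C = S"
    using \<open>C = space M - S\<close> sets.sets_into_space[OF \<open>S \<in> sets M\<close>] by auto
  have zeroS: "AE x in N. x \<in> S \<longrightarrow> g x = 0"
    by (rule well_defined_imp_zero_on_null) fact+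
  have zeroC: "AE x in N. x \<notin> C \<longrightarrow> g x = 0"
    using zeroS AE_space[of N] sets_eq_imp_space_eq[OF sets]
    by (auto elim!: eventually_rev_mp simp: \<open>C = space M - S\<close>)
  have i_ii: "ii \<longleftrightarrow> i"
    unfolding i_def ii_def
    using sets C null SC zeroC by (intro isometric_restrict_space_iff) auto
  define h where "h = (\<lambda>x. g x * complex_of_real (\<rho> x powr recip q))"
  have [measurable]: "h \<in> borel_measurable M" unfolding h_def by measurable
  have norm: "Lp_norm q N (mult_op g f) = Lp_norm q M (mult_op h f)" if "f \<in> Lp p M" for f
  proof -
    have [measurable]: "f \<in> borel_measurable M" using that by (simp add: Lp_def)
    have "Lp_norm q N (mult_op g f) = Lp_norm q M (\<lambda>x. of_real (\<rho> x powr recip q) * mult_op g f x)"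
      using zeroS \<open>1 \<le> q\<close>
      by (intro Lp_norm_lebesgue_decomposition[OF sets dec])
         (auto simp: mult_op_def elim!: eventually_mono)
    then show ?thesis
      by (simp add: mult_op_def h_def mult_ac)
  qed
  let ?k = "epow (emeasure M (space M)) (recip p - recip q)"
  have "i \<longleftrightarrow> isometric_Lp p M q M (mult_op h)"
    unfolding i_def isometric_Lp_def using norm by simp
  also have "\<dots> \<longleftrightarrow> (AE x in M. ennreal (cmod (h x)) = ?k) \<and> (p \<noteq> q \<longrightarrow> is_atom M (space M))"
    using \<open>1 \<le> p\<close> \<open>1 \<le> q\<close> nontrivial by (intro isometric_mult_iff) auto
  finally have i_iff: "i \<longleftrightarrow> (AE x in M. ennreal (cmod (h x)) = ?k) \<and> (p \<noteq> q \<longrightarrow> is_atom M (space M))" .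
  have aeS: "AE x in M. x \<in> C"
  proof -
    have "AE x in M. x \<notin> S" using null by (intro AE_not_in) auto
    then show ?thesis using AE_space by eventually_elim (simp add: \<open>C = space M - S\<close>)
  qed
  have mC: "emeasure M C = emeasure M (space M)"
    using aeS by (intro emeasure_eq_AE) (auto elim!: eventually_mono)
  have onC: "(AE x\<in>C in M. P x) \<longleftrightarrow> (AE x in M. P x)" for P
    using aeS by (intro eventually_subst) (auto elim!: eventually_mono)
  \<comment> \<open>The prescribed modulus of \<open>h\<close> is not 0, so \<open>h\<close> and with it \<open>\<rho>\<close> cannot vanish.\<close>
  have "AE x in M. 0 < \<rho> x"
    if k: "AE x in M. ennreal (cmod (h x)) = ?k" and atom: "p \<noteq> q \<longrightarrow> is_atom M (space M)"
  proof -
    have "?k \<noteq> 0"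
    proof (cases "p = q")
      case False
      then have "emeasure M (space M) \<noteq> 0" "emeasure M (space M) \<noteq> \<infinity>"
        using nontrivial atom emeasure_atom_finite by auto
      then obtain t where "0 < t" "emeasure M (space M) = ennreal t"
        by (rule ennreal_finite_pos_cases)
      then show ?thesis by (simp add: epow_ennreal)
    qed simp
    then have "AE x in M. h x \<noteq> 0"
      using k by (auto elim!: eventually_mono)
    then show ?thesis
      using nonneg by eventually_elim (auto simp: h_def less_le)
  qed
  then have "i \<longleftrightarrow> iii"
    unfolding i_iff iii_def mC onC fun_cong[OF h_def, symmetric] by blast
  then show ?thesis
    using i_ii by blast
qed

end
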